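(* Let $\mathcal E$ be a system of $\vee$-morcave equations over $\overline{\mathbb R}$ with finite variable set $\mathbf X$, and assume $\mathcal E$ is in standard form. Then the $\vee$-strategy improvement algorithm (started with the $\vee$-strategy $\sigma_{\mathrm{init}}$ selecting $-\infty$ in every equation and with $\rho_{\mathrm{init}}$ the assignment that is constantly $-\infty$, and run with any $\vee$-strategy improvement operator) computes the least solution $\mu[\![\mathcal E]\!]$ of $\mathcal E$, and it performs at most $|\mathbf X|\cdot|\Sigma_{\mathcal E}|$ $\vee$-strategy improvement steps (iterations of its loop), where $\Sigma_{\mathcal E}$ is the set of all $\vee$-strategies for $\mathcal E$.
   Context: Order-concavity. $\overline{\mathbb R}=\mathbb R\cup\{\pm\infty\}$; $\overline{\mathbb R}^n$ is ordered componentwise. For $f:\overline{\mathbb R}^n\to\overline{\mathbb R}$ let $\mathrm{fdom}(f)=\{x\in\mathbb R^n\mid f(x)\in\mathbb R\}$. For $I:\{1,\dots,n\}\to\{-\infty,\mathsf{id},\infty\}$ (the constant function $-\infty$, the identity, the constant function $\infty$) let $f^{(I)}(x)=f(I(1)(x_1),\dots,I(n)(x_n))$. A set $X\subseteq\mathbb R^n$ is order-convex if it contains $\lambda x+(1-\lambda)y$ for all comparable $x,y\in X$ (i.e. $x\le y$ or $y\le x$), $\lambda\in[0,1]$. $f$ is order-concave iff for all $I$: (1) $\mathrm{fdom}(f^{(I)})$ is order-convex; (2) $f^{(I)}(\lambda x+(1-\lambda)y)\ge\lambda f^{(I)}(x)+(1-\lambda)f^{(I)}(y)$ for all comparable $x,y\in\mathrm{fdom}(f^{(I)})$,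 $\lambda\in[0,1]$; (3) if $\mathrm{fdom}(f^{(I)})\ne\emptyset$ then $f^{(I)}(x)<\infty$ for all $x\in\mathbb R^n$. $f$ is morcave iff it is monotone and order-concave. Equation systems. A system $\mathcal E$ of equations over $\overline{\mathbb R}$ is a finite set $\{\mathbf x_1=e_1,\dots,\mathbf x_n=e_n\}$ with pairwise distinct variables, $\mathbf X=\{\mathbf x_1,\dots,\mathbf x_n\}$, where each expression $e$ has a value $[\![e]\!]\rho\in\overline{\mathbb R}$ for each variable assignment $\rho:\mathbf X\to\overline{\mathbb R}$. Put $([\![\mathcal E]\!]\rho)(\mathbf x)=[\![e]\!]\rho$ for $\mathbf x=e\in\mathcal E$. $\rho$ is a solution (pre-solution) iff $\rho=[\![\mathcal E]\!]\rho$ ($\rho\le[\![\mathcal E]\!]\rho$). $\mu[\![\mathcal E]\!]$ is the least solution, and for a pre-solution $\rho$, $\mu_{\ge\rho}[\![\mathcal E]\!]$ is the least solution that is $\ge\rho$ (these exist for monotone systems). An equation $\mathbf x=e$ is $\vee$-morcave iff $e=e_1\vee\dots\vee e_k$ ($\vee$ = maximum) with every $[\![e_j]\!]$ morcave. The system is in standard form iff every equation has the form $\mathbf x=-\infty\vee e$, i.e. the constant $-\infty$ is one of the alternatives. Strategies. A $\vee$-strategy $\sigma$ maps each right-hand side $e_1\vee\dots\vee e_k$ of $\mathcal E$ to one of the $e_j$; $\mathcal E(\sigma)=\{\mathbf x=\sigma(e)\mid\mathbf x=e\in\mathcal E\}$. For a pre-solution $\rho$ of $\mathcal E(\sigma)$,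 a $\vee$-strategy $\sigma'$ is an improvement of $\sigma$ w.r.t. $\rho$ iff (i) if $\rho$ is not a solution of $\mathcal E$, then $[\![\mathcal E(\sigma')]\!]\rho>\rho$ (i.e. $\ge$ and $\neq$); and (ii) for every right-hand side $e$, if $\sigma'(e)\ne\sigma(e)$ then $[\![\sigma'(e)]\!]\rho>[\![\sigma(e)]\!]\rho$. A $\vee$-strategy improvement operator $P_\vee$ assigns to each pair $(\sigma,\rho)$, with $\rho$ a pre-solution of $\mathcal E(\sigma)$, an improvement of $\sigma$ w.r.t. $\rho$. Algorithm. Set $\sigma:=\sigma_{\mathrm{init}}$, $\rho:=\rho_{\mathrm{init}}$. While $\rho$ is not a solution of $\mathcal E$: $\sigma:=P_\vee(\sigma,\rho)$; $\rho:=\mu_{\ge\rho}[\![\mathcal E(\sigma)]\!]$. Return $\rho$. *)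

theory Defs
  imports
    "HOL-Library.Cardinality"
    "HOL-Library.Extended_Real"
    "HOL-Library.FuncSet"
    "HOL-Library.While_Combinator"
begin

(* Vectors over the reals or extended reals are functions on an index type 'x (finite in the
   main theorem), with the componentwise order of the function type. *)

definition fdom :: "(('x \<Rightarrow> ereal) \<Rightarrow> ereal) \<Rightarrow> ('x \<Rightarrow> real) set" where
  "fdom f = {x. \<bar>f (\<lambda>i. ereal (x i))\<bar> \<noteq> \<infinity>}"

definition selectors :: "('x \<Rightarrow> ereal \<Rightarrow> ereal) set" where
  "selectors = {I. \<forall>i. I i \<in> {(\<lambda>_. - \<infinity>), id, (\<lambda>_. \<infinity>)}}"

definition select_args ::
  "(('x \<Rightarrow> ereal) \<Rightarrow> ereal) \<Rightarrow> ('x \<Rightarrow> ereal \<Rightarrow> ereal) \<Rightarrow> ('x \<Rightarrow> ereal) \<Rightarrow> ereal" where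
  "select_args f I x = f (\<lambda>i. I i (x i))"

definition convex_comb :: "real \<Rightarrow> ('x \<Rightarrow> real) \<Rightarrow> ('x \<Rightarrow> real) \<Rightarrow> 'x \<Rightarrow> real" where
  "convex_comb l x y = (\<lambda>i. l * x i + (1 - l) * y i)"

definition order_convex :: "('x \<Rightarrow> real) set \<Rightarrow> bool" where
  "order_convex X \<longleftrightarrow>
    (\<forall>x\<in>X. \<forall>y\<in>X. \<forall>l\<in>{0..1}. (x \<le> y \<or> y \<le> x) \<longrightarrow> convex_comb l x y \<in> X)"

definition order_concave :: "(('x \<Rightarrow> ereal) \<Rightarrow> ereal) \<Rightarrow> bool" where
  "order_concave f \<longleftrightarrow>
    (\<forall>I\<in>selectors. let g = select_args f I in
      order_convex (fdom g) \<and>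
      (\<forall>x\<in>fdom g. \<forall>y\<in>fdom g. \<forall>l\<in>{0..1}. (x \<le> y \<or> y \<le> x) \<longrightarrow>
        g (\<lambda>i. ereal (convex_comb l x y i)) \<ge>
          ereal l * g (\<lambda>i. ereal (x i)) + ereal (1 - l) * g (\<lambda>i. ereal (y i))) \<and>
      (fdom g \<noteq> {} \<longrightarrow> (\<forall>x. g (\<lambda>i. ereal (x i)) < \<infinity>)))"

definition morcave :: "(('x \<Rightarrow> ereal) \<Rightarrow> ereal) \<Rightarrow> bool" where
  "morcave f \<longleftrightarrow> mono f \<and> order_concave f"

type_synonym 'x assignment = "'x \<Rightarrow> ereal"

type_synonym ('x, 'e) semantics = "'e \<Rightarrow> 'x assignment \<Rightarrow> ereal"

(* 'e is an arbitrary type of expressions, interpreted by a semantics. The list [e1, ..., ek]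
   stands for the right-hand side e1 \<or> ... \<or> ek; only nonempty lists are meaningful. A system
   assigns to each variable its right-hand side, and different variables may share one. *)
type_synonym ('x, 'e) system = "'x \<Rightarrow> 'e list"

definition rhs_val :: "('x, 'e) semantics \<Rightarrow> 'e list \<Rightarrow> 'x assignment \<Rightarrow> ereal" where
  "rhs_val sem e \<rho> = Max ((\<lambda>a. sem a \<rho>) ` set e)"

definition system_val ::
  "('x, 'e) semantics \<Rightarrow> ('x, 'e) system \<Rightarrow> 'x assignment \<Rightarrow> 'x assignment" where
  "system_val sem E \<rho> = (\<lambda>x. rhs_val sem (E x) \<rho>)"

definition solution :: "('x, 'e) semantics \<Rightarrow> ('x, 'e) system \<Rightarrow> 'x assignment \<Rightarrow> bool" where
  "solution sem E \<rho> \<longleftrightarrow> \<rho> = system_val sem E \<rho>"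

definition pre_solution :: "('x, 'e) semantics \<Rightarrow> ('x, 'e) system \<Rightarrow> 'x assignment \<Rightarrow> bool" where
  "pre_solution sem E \<rho> \<longleftrightarrow> \<rho> \<le> system_val sem E \<rho>"

definition least_solution :: "('x, 'e) semantics \<Rightarrow> ('x, 'e) system \<Rightarrow> 'x assignment" where
  "least_solution sem E = (LEAST \<rho>. solution sem E \<rho>)"

definition least_solution_above ::
  "('x, 'e) semantics \<Rightarrow> ('x, 'e) system \<Rightarrow> 'x assignment \<Rightarrow> 'x assignment" where
  "least_solution_above sem E \<rho> = (LEAST \<rho>'. solution sem E \<rho>' \<and> \<rho> \<le> \<rho>')"

(* The LEAST operators above denote genuine least solutions for monotone systems. *)

lemma least_solution_above_wf:
  assumes mono: "mono (system_val sem E)" and pre: "pre_solution sem E \<rho>"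
  shows "solution sem E (least_solution_above sem E \<rho>)"
    and "\<rho> \<le> least_solution_above sem E \<rho>"
    and "\<And>\<rho>'. solution sem E \<rho>' \<Longrightarrow> \<rho> \<le> \<rho>' \<Longrightarrow> least_solution_above sem E \<rho> \<le> \<rho>'"
proof -
  let ?F = "system_val sem E"
  let ?G = "\<lambda>r. sup \<rho> (?F r)"
  let ?m = "lfp ?G"
  have "mono ?G"
    using mono by (auto simp: mono_def intro: le_supI2)
  then have eq: "?m = ?G ?m"
    by (rule lfp_unfold)
  then have ge: "\<rho> \<le> ?m"
    by (metis sup.cobounded1)
  then have "\<rho> \<le> ?F ?m"
    using pre monoD[OF mono ge] by (auto simp: pre_solution_def intro: order_trans)
  then have sol: "solution sem E ?m"
    using eq by (simp add: solution_def sup.absorb2)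
  have least: "?m \<le> \<rho>'" if "solution sem E \<rho>'" "\<rho> \<le> \<rho>'" for \<rho>'
    using that by (intro lfp_lowerbound) (simp add: solution_def)
  have m: "least_solution_above sem E \<rho> = ?m"
    unfolding least_solution_above_def using sol ge least by (intro Least_equality) auto
  show "solution sem E (least_solution_above sem E \<rho>)"
    and "\<rho> \<le> least_solution_above sem E \<rho>"
    and "\<And>\<rho>'. solution sem E \<rho>' \<Longrightarrow> \<rho> \<le> \<rho>' \<Longrightarrow> least_solution_above sem E \<rho> \<le> \<rho>'"
    using sol ge least by (simp_all add: m)
qed

lemma least_solution_wf:
  assumes "mono (system_val sem E)"
  shows "solution sem E (least_solution sem E)"
    and "\<And>\<rho>'. solution sem E \<rho>' \<Longrightarrow> least_solution sem E \<le> \<rho>'"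
proof -
  have "pre_solution sem E bot" and "least_solution sem E = least_solution_above sem E bot"
    by (simp_all add: pre_solution_def least_solution_def least_solution_above_def)
  then show "solution sem E (least_solution sem E)"
    and "\<And>\<rho>'. solution sem E \<rho>' \<Longrightarrow> least_solution sem E \<le> \<rho>'"
    using least_solution_above_wf[OF assms] by simp_all
qed

definition join_morcave :: "('x, 'e) semantics \<Rightarrow> ('x, 'e) system \<Rightarrow> bool" where
  "join_morcave sem E \<longleftrightarrow> (\<forall>x. E x \<noteq> [] \<and> (\<forall>a\<in>set (E x). morcave (sem a)))"

(* The parameter ninf is the expression denoting the constant minus infinity. *)
definition standard_form :: "'e \<Rightarrow> ('x, 'e) system \<Rightarrow> bool" where
  "standard_form ninf E \<longleftrightarrow> (\<forall>x. ninf \<in> set (E x))"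

(* Strategies choose per right-hand side, not per variable; extensionality outside the set of
   right-hand sides makes the cardinality of this set the number of strategies. *)
definition strategies :: "('x, 'e) system \<Rightarrow> ('e list \<Rightarrow> 'e) set" where
  "strategies E = (\<Pi>\<^sub>E e\<in>range E. set e)"

definition apply_strategy :: "('x, 'e) system \<Rightarrow> ('e list \<Rightarrow> 'e) \<Rightarrow> ('x, 'e) system" where
  "apply_strategy E \<sigma> = (\<lambda>x. [\<sigma> (E x)])"

definition improvement ::
  "('x, 'e) semantics \<Rightarrow> ('x, 'e) system \<Rightarrow> ('e list \<Rightarrow> 'e) \<Rightarrow> 'x assignment
    \<Rightarrow> ('e list \<Rightarrow> 'e) \<Rightarrow> bool" where
  "improvement sem E \<sigma> \<rho> \<sigma>' \<longleftrightarrow>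
    \<sigma>' \<in> strategies E \<and>
    (\<not> solution sem E \<rho> \<longrightarrow> system_val sem (apply_strategy E \<sigma>') \<rho> > \<rho>) \<and>
    (\<forall>e\<in>range E. \<sigma>' e \<noteq> \<sigma> e \<longrightarrow> sem (\<sigma>' e) \<rho> > sem (\<sigma> e) \<rho>)"

definition improvement_operator ::
  "('x, 'e) semantics \<Rightarrow> ('x, 'e) system
    \<Rightarrow> (('e list \<Rightarrow> 'e) \<Rightarrow> 'x assignment \<Rightarrow> ('e list \<Rightarrow> 'e)) \<Rightarrow> bool" where
  "improvement_operator sem E P \<longleftrightarrow>
    (\<forall>\<sigma>\<in>strategies E. \<forall>\<rho>. pre_solution sem (apply_strategy E \<sigma>) \<rho> \<longrightarrow>
      improvement sem E \<sigma> \<rho> (P \<sigma> \<rho>))"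

(* The third component of the state counts the iterations of the loop; the result is None iff
   the loop does not terminate. *)
definition strategy_improvement ::
  "('x, 'e) semantics \<Rightarrow> ('x, 'e) system
    \<Rightarrow> (('e list \<Rightarrow> 'e) \<Rightarrow> 'x assignment \<Rightarrow> ('e list \<Rightarrow> 'e))
    \<Rightarrow> ('e list \<Rightarrow> 'e) \<Rightarrow> 'x assignment
    \<Rightarrow> (('e list \<Rightarrow> 'e) \<times> 'x assignment \<times> nat) option" where
  "strategy_improvement sem E P \<sigma>init \<rho>init =
    while_option
      (\<lambda>(\<sigma>, \<rho>, n). \<not> solution sem E \<rho>)
      (\<lambda>(\<sigma>, \<rho>, n). let \<sigma>' = P \<sigma> \<rho> in
        (\<sigma>', least_solution_above sem (apply_strategy E \<sigma>') \<rho>, Suc n))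
      (\<sigma>init, \<rho>init, 0)"

end

(* Call a solution \<rho> of a monotone operator F tight if no nonzero direction d \<ge> 0 makes
   all \<rho> - \<epsilon> d, for small \<epsilon> > 0, post-fixpoints r (F r \<le> r) of F. The iterates of the algorithm
   are tight solutions of their strategy: where a nonzero d would decrease the new iterate \<rho>', either
   it has not moved, so the strategy is unchanged there and tightness of \<rho> applies, or \<rho>' lies
   strictly above \<rho>, contradicting leastness. By concavity a tight solution admits no larger
   solution with the same infinite entries: otherwise the line through both would, extended
   downwards, consist of post-fixpoints. The -\<infinity> entries are determined by the strategy and the
   set of \<infinity> entries grows without ever being everything before termination, so each strategy
   occurs at most CARD('x) times before the algorithm stops. *)
theory Submission
  imports Defs
begin

section \<open>Tightness and its preservation by improvement steps\<close>

definition lower :: "('x \<Rightarrow> ereal) \<Rightarrow> ('x \<Rightarrow> real) \<Rightarrow> real \<Rightarrow> 'x \<Rightarrow> ereal" where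
  "lower \<rho> d \<epsilon> = (\<lambda>i. \<rho> i - ereal (\<epsilon> * d i))"

text \<open>Directions are supported on finite entries: at an infinite entry \<open>lower\<close>
  ignores \<open>d\<close>, so a direction living there would leave \<rho> in place and refute
  tightness of every fixpoint with an infinite entry.\<close>

definition tight :: "(('x \<Rightarrow> ereal) \<Rightarrow> 'x \<Rightarrow> ereal) \<Rightarrow> ('x \<Rightarrow> ereal) \<Rightarrow> bool" where
  "tight F \<rho> \<longleftrightarrow> (\<forall>d. (\<forall>i. 0 \<le> d i) \<longrightarrow> (\<forall>i. d i \<noteq> 0 \<longrightarrow> \<bar>\<rho> i\<bar> \<noteq> \<infinity>) \<longrightarrow>
    (\<forall>\<^sub>F \<epsilon> in at_right 0. F (lower \<rho> d \<epsilon>) \<le> lower \<rho> d \<epsilon>) \<longrightarrow> (\<forall>i. d i = 0))"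

lemma tightD:
  assumes "tight F \<rho>" "\<And>i. 0 \<le> d i" "\<And>i. d i \<noteq> 0 \<Longrightarrow> \<bar>\<rho> i\<bar> \<noteq> \<infinity>"
    and "\<forall>\<^sub>F \<epsilon> in at_right 0. F (lower \<rho> d \<epsilon>) \<le> lower \<rho> d \<epsilon>"
  shows "d i = 0"
  using assms unfolding tight_def by blast

lemma lower_le: "0 < \<epsilon> \<Longrightarrow> (\<And>i. 0 \<le> d i) \<Longrightarrow> lower \<rho> d \<epsilon> \<le> \<rho>"
  by (auto simp: lower_def le_fun_def intro!: ereal_diff_le_self)

lemma eventually_le_lower:
  assumes "a < b" "\<bar>b\<bar> \<noteq> \<infinity>"
  shows "\<forall>\<^sub>F \<epsilon> in at_right 0. a \<le> b - ereal (\<epsilon> * c)"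
proof -
  obtain r where r: "b = ereal r"
    using assms(2) by auto
  have "((\<lambda>\<epsilon>. r - \<epsilon> * c) \<longlongrightarrow> r - 0 * c) (at_right 0)"
    by (intro tendsto_intros)
  then have "((\<lambda>\<epsilon>. b - ereal (\<epsilon> * c)) \<longlongrightarrow> b) (at_right 0)"
    by (simp add: r)
  then have "\<forall>\<^sub>F \<epsilon> in at_right 0. a < b - ereal (\<epsilon> * c)"
    using assms(1) order_tendstoD(1) by blast
  then show ?thesis
    by (rule eventually_mono) simp
qed

text \<open>If \<open>d\<close> decreases \<rho>', its restriction \<open>e\<close> to the entries
  with \<open>\<rho> i = \<rho>' i\<close> decreases \<rho> for \<open>F\<close>, which agrees with
  \<open>F'\<close> there. Tightness of \<rho> makes \<open>e\<close> zero, so small decreases of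
  \<rho>' stay above \<rho>, and leastness forces \<open>d\<close> to vanish.\<close>

lemma tight_improve:
  fixes F F' :: "('x::finite \<Rightarrow> ereal) \<Rightarrow> 'x \<Rightarrow> ereal"
  assumes mono: "mono F" "mono F'"
    and tight: "tight F \<rho>" and sol: "F \<rho> = \<rho>" and pre: "\<rho> \<le> F' \<rho>"
    and agree: "\<And>i r. F' \<rho> i = \<rho> i \<Longrightarrow> F' r i = F r i"
    and sol': "F' \<rho>' = \<rho>'" and above: "\<rho> \<le> \<rho>'"
    and least: "\<And>r. F' r \<le> r \<Longrightarrow> \<rho> \<le> r \<Longrightarrow> \<rho>' \<le> r"
  shows "tight F' \<rho>'"
  unfolding tight_def
proof (intro allI impI)
  fix d i
  assume "\<forall>i. 0 \<le> d i" and "\<forall>i. d i \<noteq> 0 \<longrightarrow> \<bar>\<rho>' i\<bar> \<noteq> \<infinity>"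
    and post: "\<forall>\<^sub>F \<epsilon> in at_right 0. F' (lower \<rho>' d \<epsilon>) \<le> lower \<rho>' d \<epsilon>"
  then have d: "\<And>i. 0 \<le> d i" and fin: "\<And>i. d i \<noteq> 0 \<Longrightarrow> \<bar>\<rho>' i\<bar> \<noteq> \<infinity>"
    by auto
  define e where "e i = (if \<rho> i = \<rho>' i then d i else 0)" for i
  have pos: "\<forall>\<^sub>F \<epsilon> in at_right 0. (0::real) < \<epsilon>"
    by (simp add: eventually_at_right_less)
  have "\<forall>\<^sub>F \<epsilon> in at_right 0. \<forall>i. lower \<rho> e \<epsilon> i \<le> lower \<rho>' d \<epsilon> i"
  proof (rule eventually_all_finite)
    fix i
    consider "\<rho> i = \<rho>' i" | "\<rho> i \<noteq> \<rho>' i" "d i = 0" | "\<rho> i \<noteq> \<rho>' i" "d i \<noteq> 0"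
      by blast
    then show "\<forall>\<^sub>F \<epsilon> in at_right 0. lower \<rho> e \<epsilon> i \<le> lower \<rho>' d \<epsilon> i"
    proof cases
      \<comment> \<open>A moved entry has a strict gap that a small decrease of \<rho>' does not
        close; at the other entries the comparison holds for every \<epsilon>.\<close>
      case 3
      then have "\<rho> i < \<rho>' i"
        using above by (simp add: le_fun_def less_le)
      then show ?thesis
        using eventually_le_lower[of "\<rho> i" "\<rho>' i" "d i"] fin 3 by (simp add: lower_def e_def)
    qed (use above in \<open>auto simp: lower_def e_def le_fun_def\<close>)
  qed
  then have le: "\<forall>\<^sub>F \<epsilon> in at_right 0. lower \<rho> e \<epsilon> \<le> lower \<rho>' d \<epsilon>"
    by (simp add: le_fun_def)
  have "\<forall>\<^sub>F \<epsilon> in at_right 0. F (lower \<rho> e \<epsilon>) \<le> lower \<rho> e \<epsilon>"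
    using le post pos
  proof eventually_elim
    case (elim \<epsilon>)
    show ?case
    proof (rule le_funI)
      fix i
      show "F (lower \<rho> e \<epsilon>) i \<le> lower \<rho> e \<epsilon> i"
      proof (cases "\<rho> i = \<rho>' i")
        case True
        \<comment> \<open>Monotonicity squeezes \<open>F' \<rho> i\<close> between
          \<open>\<rho> i\<close> and \<open>F' \<rho>' i = \<rho>' i = \<rho> i\<close>, so that
          \<open>agree\<close> applies at \<open>i\<close>.\<close>
        have "F' \<rho> i \<le> \<rho> i"
          using le_funD[OF monoD[OF mono(2) above], of i] sol' True by simp
        then have "F (lower \<rho> e \<epsilon>) i = F' (lower \<rho> e \<epsilon>) i"
          using agree le_funD[OF pre, of i] by simp
        also have "\<dots> \<le> F' (lower \<rho>' d \<epsilon>) i"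
          using monoD[OF mono(2) elim(1)] by (rule le_funD)
        also have "\<dots> \<le> lower \<rho>' d \<epsilon> i"
          using elim(2) by (rule le_funD)
        also have "\<dots> = lower \<rho> e \<epsilon> i"
          using True by (simp add: lower_def e_def)
        finally show ?thesis .
      next
        case False
        have "lower \<rho> e \<epsilon> \<le> \<rho>"
          by (rule lower_le[OF elim(3)]) (simp add: e_def d)
        then have "F (lower \<rho> e \<epsilon>) i \<le> \<rho> i"
          using le_funD[OF monoD[OF mono(1)], of _ \<rho> i] sol by simp
        then show ?thesis
          using False by (simp add: lower_def e_def)
      qed
    qed
  qed
  then have e: "e j = 0" for j
    by (rule tightD[OF tight, rotated 2]) (use fin in \<open>auto simp: e_def d split: if_splits\<close>)
  have "\<forall>\<^sub>F \<epsilon> in at_right 0. lower \<rho> e \<epsilon> \<le> lower \<rho>' d \<epsilon> \<and>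
      F' (lower \<rho>' d \<epsilon>) \<le> lower \<rho>' d \<epsilon> \<and> 0 < \<epsilon>"
    using le post pos by (intro eventually_conj)
  then obtain \<epsilon> where "lower \<rho> e \<epsilon> \<le> lower \<rho>' d \<epsilon>"
      "F' (lower \<rho>' d \<epsilon>) \<le> lower \<rho>' d \<epsilon>" and \<epsilon>: "0 < \<epsilon>"
    using eventually_happens'[OF trivial_limit_at_right_real] by blast
  moreover have "lower \<rho> e \<epsilon> = \<rho>"
    by (simp add: lower_def e)
  \<comment> \<open>With \<open>e\<close> zero, the lowered \<rho>' is a post-fixpoint of
    \<open>F'\<close> above \<rho>, so leastness applies to it.\<close>
  ultimately have "\<rho>' i \<le> lower \<rho>' d \<epsilon> i"
    using least[of "lower \<rho>' d \<epsilon>"] by (simp add: le_fun_def)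
  then show "d i = 0"
    using fin[of i] d[of i] \<epsilon> mult_pos_pos[of \<epsilon> "d i"]
    by (cases "\<rho>' i") (auto simp: lower_def mult_le_0_iff)
qed

section \<open>Concavity along lines and uniqueness of tight solutions\<close>

text \<open>\<rho> lies between \<open>\<rho> + d\<close> and \<open>\<rho> - \<epsilon> d\<close>,
  so by concavity the increment \<open>b\<close> ahead bounds the value behind. A selector that
  freezes the infinite entries of \<rho> turns this into a statement about comparable real
  vectors.\<close>

lemma order_concave_extrapolate:
  assumes conc: "order_concave f"
    and d: "\<And>j. 0 \<le> d j" and \<epsilon>: "0 < \<epsilon>"
    and inf: "\<And>j. \<bar>\<rho> j\<bar> = \<infinity> \<Longrightarrow> d j = 0"
    and val: "f \<rho> = ereal a" and up: "f (\<lambda>j. \<rho> j + ereal (d j)) = ereal (a + b)"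
  shows "f (lower \<rho> d \<epsilon>) \<le> ereal (a - \<epsilon> * b)"
proof -
  define I :: "'a \<Rightarrow> ereal \<Rightarrow> ereal" where
    "I j = (if \<rho> j = \<infinity> then (\<lambda>_. \<infinity>) else if \<rho> j = - \<infinity> then (\<lambda>_. - \<infinity>) else id)" for j
  define r where "r j = real_of_ereal (\<rho> j)" for j
  define g where "g = select_args f I"
  define y where "y j = r j + d j" for j
  define z where "z j = r j - \<epsilon> * d j" for j
  \<comment> \<open>The weight for which \<open>l * y + (1 - l) * z = r\<close>.\<close>
  define l where "l = \<epsilon> / (1 + \<epsilon>)"
  have "I \<in> selectors"
    by (simp add: selectors_def I_def)
  then have conv: "ereal l * g (\<lambda>i. ereal (x i)) + ereal (1 - l) * g (\<lambda>i. ereal (x' i))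
      \<le> g (\<lambda>i. ereal (convex_comb l x x' i))"
      if "x \<in> fdom g" "x' \<in> fdom g" "l \<in> {0..1}" "x' \<le> x" for x x' l
    using conc that unfolding order_concave_def Let_def g_def by blast
  have top: "g (\<lambda>i. ereal (x i)) < \<infinity>" if "fdom g \<noteq> {}" for x
    using conc \<open>I \<in> selectors\<close> that unfolding order_concave_def Let_def g_def by blast
  \<comment> \<open>At an infinite entry \<open>r j\<close> is only the default 0, which the
    constant function \<open>I j\<close> ignores.\<close>
  have I: "I j (ereal (r j + c)) = \<rho> j + ereal c" for j c
    by (cases "\<rho> j") (auto simp: I_def r_def)
  have gr: "g (\<lambda>j. ereal (r j)) = ereal a"
    using val I[of _ 0] by (simp add: g_def select_args_def zero_ereal_def[symmetric])
  have gy: "g (\<lambda>j. ereal (y j)) = ereal (a + b)"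
    using up I by (simp add: g_def select_args_def y_def)
  have gz: "g (\<lambda>j. ereal (z j)) = f (lower \<rho> d \<epsilon>)"
    using I[of _ "- (\<epsilon> * d _)"]
    by (simp add: g_def select_args_def z_def lower_def minus_ereal_def)
  have y: "y \<in> fdom g"
    by (simp add: fdom_def gy)
  show ?thesis
  proof (cases "g (\<lambda>j. ereal (z j))")
    case (real c)
    then have z: "z \<in> fdom g"
      by (simp add: fdom_def)
    have l: "l \<in> {0..1}"
      using \<epsilon> by (simp add: l_def)
    have zy: "z \<le> y"
    proof (rule le_funI)
      fix j
      have "0 \<le> \<epsilon> * d j"
        using d \<epsilon> by simp
      then show "z j \<le> y j"
        using d[of j] by (simp add: z_def y_def)
    qed
    have "(1 - l) * \<epsilon> = l"
      using \<epsilon> by (simp add: l_def field_simps)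
    moreover have "convex_comb l y z j = r j + (l - (1 - l) * \<epsilon>) * d j" for j
      by (simp add: convex_comb_def y_def z_def algebra_simps)
    ultimately have "convex_comb l y z = r"
      by (simp add: fun_eq_iff)
    with conv[OF y z l zy] have "l * (a + b) + (1 - l) * c \<le> a"
      by (simp add: gr gy real)
    moreover have "1 - l = 1 / (1 + \<epsilon>)"
      using \<epsilon> by (simp add: l_def field_simps)
    ultimately have "(\<epsilon> * (a + b) + c) / (1 + \<epsilon>) \<le> a"
      by (simp add: l_def add_divide_distrib)
    then have "c \<le> a - \<epsilon> * b"
      using \<epsilon> by (simp add: pos_divide_le_eq algebra_simps)
    then show ?thesis
      by (simp add: gz[symmetric] real)
  next
    \<comment> \<open>Excluded by the third clause of order-concavity, since \<open>y\<close> lies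
      in the finite domain.\<close>
    case PInf
    then show ?thesis
      using top[of z] y by auto
  qed (use gz in simp)
qed

text \<open>Both ends being fixpoints, a finite entry \<open>i\<close> of \<open>F\<close> grows by
  exactly \<open>d i\<close> from \<rho> to \<open>\<rho> + d = \<rho>'\<close>. Extrapolating
  backwards makes every \<open>\<rho> - \<epsilon> d\<close> a post-fixpoint, so tightness forces
  \<open>d\<close> to be zero.\<close>

lemma tight_unique:
  fixes F :: "('x \<Rightarrow> ereal) \<Rightarrow> 'x \<Rightarrow> ereal"
  assumes conc: "\<And>i. order_concave (\<lambda>r. F r i)" and mono: "mono F"
    and tight: "tight F \<rho>" and sol: "F \<rho> = \<rho>" and sol': "F \<rho>' = \<rho>'" and le: "\<rho> \<le> \<rho>'"
    and top: "\<And>i. \<rho> i = \<infinity> \<longleftrightarrow> \<rho>' i = \<infinity>" and bot: "\<And>i. \<rho> i = - \<infinity> \<longleftrightarrow> \<rho>' i = - \<infinity>"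
  shows "\<rho> = \<rho>'"
proof -
  define d where "d i = (if \<bar>\<rho> i\<bar> = \<infinity> then 0 else real_of_ereal (\<rho>' i) - real_of_ereal (\<rho> i))" for i
  have add: "\<rho> i + ereal (d i) = \<rho>' i" for i
    using top[of i] bot[of i] by (cases "\<rho> i"; cases "\<rho>' i") (auto simp: d_def)
  have d: "0 \<le> d i" for i
    using top[of i] bot[of i] le_funD[OF le, of i]
    by (cases "\<rho> i"; cases "\<rho>' i") (auto simp: d_def)
  have post: "F (lower \<rho> d \<epsilon>) i \<le> lower \<rho> d \<epsilon> i" if \<epsilon>: "0 < \<epsilon>" for \<epsilon> i
  proof (cases "\<rho> i")
    case (real a)
    have "F (lower \<rho> d \<epsilon>) i \<le> ereal (a - \<epsilon> * d i)"
    proof (rule order_concave_extrapolate[OF conc d \<epsilon>])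
      show "F \<rho> i = ereal a"
        by (simp add: sol real)
      show "F (\<lambda>j. \<rho> j + ereal (d j)) i = ereal (a + d i)"
        using add[of i] by (simp add: add sol' real)
    qed (simp add: d_def)
    then show ?thesis
      by (simp add: lower_def real)
  next
    case MInf
    have "F (lower \<rho> d \<epsilon>) i \<le> F \<rho> i"
      using monoD[OF mono lower_le[OF \<epsilon> d]] by (rule le_funD)
    then show ?thesis
      by (simp add: sol MInf)
  qed (simp add: lower_def)
  have "d i = 0" for i
  proof (rule tightD[OF tight d])
    show "\<forall>\<^sub>F \<epsilon> in at_right 0. F (lower \<rho> d \<epsilon>) \<le> lower \<rho> d \<epsilon>"
      using eventually_at_right_less[of "0::real"]
      by (rule eventually_mono) (simp add: le_fun_def post)
  qed (simp add: d_def split: if_splits)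
  then show ?thesis
    using add by (metis add.right_neutral ext zero_ereal_def)
qed

section \<open>Monotone systems and strategies\<close>

text \<open>The least fixpoint of the system joined with \<rho> is a solution above \<rho> and lies
  below every such post-fixpoint. Bounds by post-fixpoints are required because lowered iterates and
  the least solution of \<open>E\<close> need not solve the system of a strategy.\<close>

lemma least_solution_above_lowerbound:
  assumes mono: "mono (system_val sem E)" and pre: "pre_solution sem E \<rho>"
    and post: "system_val sem E r \<le> r" and above: "\<rho> \<le> r"
  shows "least_solution_above sem E \<rho> \<le> r"
proof -
  let ?G = "\<lambda>r. sup \<rho> (system_val sem E r)"
  have "mono ?G"
    using mono by (auto simp: mono_def intro: le_supI2)
  then have eq: "lfp ?G = ?G (lfp ?G)"
    by (rule lfp_unfold)
  then have ge: "\<rho> \<le> lfp ?G"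
    by (metis sup.cobounded1)
  then have "\<rho> \<le> system_val sem E (lfp ?G)"
    using pre monoD[OF mono ge] by (auto simp: pre_solution_def intro: order_trans)
  then have "solution sem E (lfp ?G)"
    using eq by (simp add: solution_def sup.absorb2)
  then have "least_solution_above sem E \<rho> \<le> lfp ?G"
    using least_solution_above_wf(3)[OF mono pre] ge by blast
  also have "\<dots> \<le> r"
    using post above by (intro lfp_lowerbound) simp
  finally show ?thesis .
qed

lemma system_val_apply_strategy [simp]:
  "system_val sem (apply_strategy E \<sigma>) \<rho> x = sem (\<sigma> (E x)) \<rho>"
  by (simp add: system_val_def apply_strategy_def rhs_val_def)

lemma mono_system_val:
  fixes sem :: "('x, 'e) semantics"
  assumes "join_morcave sem E"
  shows "mono (system_val sem E)"
proof (rule monoI, rule le_funI)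
  fix \<rho> \<rho>' :: "'x assignment" and x
  assume le: "\<rho> \<le> \<rho>'"
  have "sem a \<rho> \<le> Max ((\<lambda>a. sem a \<rho>') ` set (E x))" if "a \<in> set (E x)" for a
  proof -
    have "sem a \<rho> \<le> sem a \<rho>'"
      using assms that le by (auto simp: join_morcave_def morcave_def mono_def)
    also have "\<dots> \<le> Max ((\<lambda>a. sem a \<rho>') ` set (E x))"
      using that by simp
    finally show ?thesis .
  qed
  then show "system_val sem E \<rho> x \<le> system_val sem E \<rho>' x"
    using assms by (simp add: system_val_def rhs_val_def join_morcave_def)
qed

lemma strategies_in_rhs: "\<sigma> \<in> strategies E \<Longrightarrow> \<sigma> (E x) \<in> set (E x)"
  by (auto simp: strategies_def)

lemma finite_strategies: "finite (strategies (E :: ('x::finite, 'e) system))"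
  by (auto simp: strategies_def intro: finite_PiE)

lemma join_morcave_apply_strategy:
  "join_morcave sem E \<Longrightarrow> \<sigma> \<in> strategies E \<Longrightarrow> join_morcave sem (apply_strategy E \<sigma>)"
  using strategies_in_rhs by (fastforce simp: join_morcave_def apply_strategy_def)

lemma system_val_apply_strategy_le:
  assumes "\<sigma> \<in> strategies E"
  shows "system_val sem (apply_strategy E \<sigma>) \<rho> \<le> system_val sem E \<rho>"
proof (rule le_funI)
  fix x
  show "system_val sem (apply_strategy E \<sigma>) \<rho> x \<le> system_val sem E \<rho> x"
    using strategies_in_rhs[OF assms, of x] by (simp add: system_val_def[of sem E] rhs_val_def)
qed

section \<open>The loop invariant\<close>

locale strategy_iteration =
  fixes sem :: "('x::finite, 'e) semantics"
    and E :: "('x, 'e) system"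
    and ninf :: 'e
    and P :: "('e list \<Rightarrow> 'e) \<Rightarrow> 'x assignment \<Rightarrow> ('e list \<Rightarrow> 'e)"
  assumes ninf: "\<And>\<rho>. sem ninf \<rho> = - \<infinity>"
    and morcave: "join_morcave sem E"
    and standard: "standard_form ninf E"
    and operator: "improvement_operator sem E P"
begin

abbreviation strategy_val :: "('e list \<Rightarrow> 'e) \<Rightarrow> 'x assignment \<Rightarrow> 'x assignment" where
  "strategy_val \<sigma> \<equiv> system_val sem (apply_strategy E \<sigma>)"

lemma mono_strategy_val: "\<sigma> \<in> strategies E \<Longrightarrow> mono (strategy_val \<sigma>)"
  by (intro mono_system_val join_morcave_apply_strategy morcave)

text \<open>The iteration counter is left out; the index of \<open>run\<close> takes its
  place.\<close>

definition step where
  "step \<sigma> \<rho> = (let \<sigma>' = P \<sigma> \<rho> in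
    (\<sigma>', least_solution_above sem (apply_strategy E \<sigma>') \<rho>))"

(* The third conjunct holds because an alternative that replaces ninf has a value above
   -\<infinity> at the moment it is chosen. *)
definition invariant :: "('e list \<Rightarrow> 'e) \<Rightarrow> 'x assignment \<Rightarrow> bool" where
  "invariant \<sigma> \<rho> \<longleftrightarrow> \<sigma> \<in> strategies E \<and> strategy_val \<sigma> \<rho> = \<rho> \<and>
    (\<forall>x. \<sigma> (E x) = ninf \<longleftrightarrow> \<rho> x = - \<infinity>) \<and>
    \<rho> \<le> least_solution sem E \<and> tight (strategy_val \<sigma>) \<rho>"

text \<open>No entry is finite, so only the zero direction is admissible and tightness is
  trivial.\<close>

lemma invariant_init: "invariant (\<lambda>e\<in>range E. ninf) (\<lambda>_. - \<infinity>)"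
proof -
  have "(\<lambda>e\<in>range E. ninf) \<in> strategies E"
    using standard by (auto simp: strategies_def standard_form_def)
  then show ?thesis
    by (simp add: invariant_def fun_eq_iff ninf tight_def le_fun_def)
qed

text \<open>One analysis of the improvement yields all three claims. Only the strict increase
  depends on \<rho> not being a solution, so the invariant can be followed past termination.\<close>

lemma
  assumes inv: "invariant \<sigma> \<rho>" and step: "step \<sigma> \<rho> = (\<sigma>', \<rho>')"
  shows invariant_step: "invariant \<sigma>' \<rho>'"
    and step_le: "\<rho> \<le> \<rho>'"
    and step_less: "\<not> solution sem E \<rho> \<Longrightarrow> \<rho> < \<rho>'"
proof -
  let ?F = "strategy_val \<sigma>" and ?F' = "strategy_val \<sigma>'"
  have \<sigma>: "\<sigma> \<in> strategies E" and sol: "?F \<rho> = \<rho>"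
    and bot: "\<And>x. \<sigma> (E x) = ninf \<longleftrightarrow> \<rho> x = - \<infinity>"
    and below: "\<rho> \<le> least_solution sem E" and tight: "tight ?F \<rho>"
    using inv by (auto simp: invariant_def)
  have \<sigma>'_eq: "\<sigma>' = P \<sigma> \<rho>" and \<rho>'_eq: "\<rho>' = least_solution_above sem (apply_strategy E \<sigma>') \<rho>"
    using step by (auto simp: step_def Let_def)
  have "pre_solution sem (apply_strategy E \<sigma>) \<rho>"
    by (simp add: pre_solution_def sol)
  then have imp: "improvement sem E \<sigma> \<rho> \<sigma>'"
    using operator \<sigma> by (simp add: \<sigma>'_eq improvement_operator_def)
  then have \<sigma>': "\<sigma>' \<in> strategies E"
    and strict: "\<not> solution sem E \<rho> \<Longrightarrow> \<rho> < ?F' \<rho>"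
    and change: "\<And>x. \<sigma>' (E x) \<noteq> \<sigma> (E x) \<Longrightarrow> \<rho> x < ?F' \<rho> x"
    using fun_cong[OF sol] by (auto simp: improvement_def)
  \<comment> \<open>An unchanged choice keeps the value \<open>\<rho> x\<close>, a changed one
    raises it.\<close>
  have pre: "\<rho> \<le> ?F' \<rho>"
  proof (rule le_funI)
    fix x
    show "\<rho> x \<le> ?F' \<rho> x"
      using change[of x] fun_cong[OF sol, of x] by (cases "\<sigma>' (E x) = \<sigma> (E x)") auto
  qed
  note mono' = mono_strategy_val[OF \<sigma>']
  have pre': "pre_solution sem (apply_strategy E \<sigma>') \<rho>"
    using pre by (simp add: pre_solution_def)
  note wf = least_solution_above_wf[OF mono' pre', folded \<rho>'_eq]
  note lowerbound = least_solution_above_lowerbound[OF mono' pre', folded \<rho>'_eq]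
  have sol': "?F' \<rho>' = \<rho>'"
    using wf(1) by (simp add: solution_def)
  show above: "\<rho> \<le> \<rho>'"
    by (rule wf(2))
  \<comment> \<open>If \<rho>' were \<rho>, then \<rho> would solve the new strategy's system,
    against the strict increase demanded of an improvement.\<close>
  show "\<rho> < \<rho>'" if "\<not> solution sem E \<rho>"
    using above strict[OF that] sol' by (metis less_le)
  have bot': "\<sigma>' (E x) = ninf \<longleftrightarrow> \<rho>' x = - \<infinity>" for x
  proof
    assume "\<sigma>' (E x) = ninf"
    then show "\<rho>' x = - \<infinity>"
      using fun_cong[OF sol', of x] by (simp add: ninf)
  next
    \<comment> \<open>Iterates only grow, so \<open>ninf\<close> was chosen before; a switch away
      from it would put the value at \<rho>, hence at \<rho>', above -\<infinity>.\<close>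
    assume minf: "\<rho>' x = - \<infinity>"
    then have "\<sigma> (E x) = ninf"
      using le_funD[OF above, of x] bot by simp
    moreover have "?F' \<rho> x \<le> - \<infinity>"
      using le_funD[OF monoD[OF mono' above], of x] minf by (simp add: sol')
    ultimately show "\<sigma>' (E x) = ninf"
      using change[of x] by fastforce
  qed
  \<comment> \<open>A strategy's values stay below those of \<open>E\<close>, so the least solution
    of \<open>E\<close> is a post-fixpoint of the new strategy above \<rho>.\<close>
  have "system_val sem E (least_solution sem E) = least_solution sem E"
    using least_solution_wf(1)[OF mono_system_val[OF morcave]] by (simp add: solution_def)
  then have "?F' (least_solution sem E) \<le> least_solution sem E"
    using system_val_apply_strategy_le[OF \<sigma>', of sem "least_solution sem E"] by simp
  then have below': "\<rho>' \<le> least_solution sem E"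
    using below by (rule lowerbound)
  have "tight ?F' \<rho>'"
  proof (rule tight_improve[OF mono_strategy_val[OF \<sigma>] mono' tight sol pre _ sol' above lowerbound])
    fix x r
    \<comment> \<open>A switch would raise the value strictly, so a stationary value means an
      unchanged choice.\<close>
    assume "?F' \<rho> x = \<rho> x"
    then have "\<sigma>' (E x) = \<sigma> (E x)"
      using change[of x] by fastforce
    then show "?F' r x = ?F r x"
      by simp
  qed
  then show "invariant \<sigma>' \<rho>'"
    by (simp add: invariant_def \<sigma>' sol' bot' below')
qed

section \<open>Counting the iterations\<close>

text \<open>Comparability nests the sets of \<infinity> entries, so equal cardinalities make them
  equal; the -\<infinity> entries are read off the common strategy.\<close>

lemma invariant_unique:
  assumes "invariant \<sigma> \<rho>" "invariant \<sigma> \<rho>'" "\<rho> \<le> \<rho>'"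
    and card: "card {x. \<rho> x = \<infinity>} = card {x. \<rho>' x = \<infinity>}"
  shows "\<rho> = \<rho>'"
proof (rule tight_unique[of "strategy_val \<sigma>"])
  have "\<rho>' x = \<infinity>" if "\<rho> x = \<infinity>" for x
    using le_funD[OF assms(3), of x] that by simp
  then have "{x. \<rho> x = \<infinity>} = {x. \<rho>' x = \<infinity>}"
    using card by (intro card_subset_eq) auto
  then show "\<rho> x = \<infinity> \<longleftrightarrow> \<rho>' x = \<infinity>" for x
    by blast
  show "\<rho> x = - \<infinity> \<longleftrightarrow> \<rho>' x = - \<infinity>" for x
    using assms(1,2) by (metis invariant_def)
  show "order_concave (\<lambda>r. strategy_val \<sigma> r x)" for x
    using assms(1) morcave strategies_in_rhs
    by (fastforce simp: invariant_def join_morcave_def morcave_def)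
qed (use assms in \<open>auto simp: invariant_def mono_strategy_val\<close>)

text \<open>As a pre-solution of \<open>E\<close> that is not a solution, \<rho> has an entry that
  can still rise, and that entry is not \<infinity>.\<close>

lemma invariant_card_top:
  assumes "invariant \<sigma> \<rho>" "\<not> solution sem E \<rho>"
  shows "card {x. \<rho> x = \<infinity>} < CARD('x)"
proof (rule psubset_card_mono)
  have "\<rho> \<le> system_val sem E \<rho>"
    using assms(1) system_val_apply_strategy_le[of \<sigma> E sem \<rho>] by (simp add: invariant_def)
  then have "\<not> system_val sem E \<rho> \<le> \<rho>"
    using assms(2) by (auto simp: solution_def)
  then obtain x where "\<not> system_val sem E \<rho> x \<le> \<rho> x"
    by (auto simp: le_fun_def)
  then have "\<rho> x \<noteq> \<infinity>"
    by auto
  then show "{x. \<rho> x = \<infinity>} \<subset> UNIV"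
    by blast
qed simp

text \<open>The loop body is iterated without its guard, so that a state exists for every index,
  also after a solution is reached.\<close>

primrec run :: "nat \<Rightarrow> ('e list \<Rightarrow> 'e) \<times> 'x assignment" where
  "run 0 = ((\<lambda>e\<in>range E. ninf), (\<lambda>_. - \<infinity>))"
| "run (Suc k) = (case run k of (\<sigma>, \<rho>) \<Rightarrow> step \<sigma> \<rho>)"

lemma run_step: "step (fst (run k)) (snd (run k)) = (fst (run (Suc k)), snd (run (Suc k)))"
  by (simp add: split_beta)

lemma invariant_run: "invariant (fst (run k)) (snd (run k))"
proof (induction k)
  case (Suc k)
  then show ?case
    using run_step by (rule invariant_step)
qed (use invariant_init in \<open>simp only: run.simps fst_conv snd_conv\<close>)

lemma run_mono: "j \<le> k \<Longrightarrow> snd (run j) \<le> snd (run k)"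
  by (rule lift_Suc_mono_le[of "\<lambda>k. snd (run k)"]) (rule step_le[OF invariant_run run_step])

text \<open>Pigeonhole on the pairs of a number of \<infinity> entries and a strategy. In an active
  state this number is strictly below \<open>CARD('x)\<close>, so it takes at most
  \<open>CARD('x)\<close> values.\<close>

lemma run_bound:
  assumes active: "\<And>k. k < n \<Longrightarrow> \<not> solution sem E (snd (run k))"
  shows "n \<le> CARD('x) * card (strategies E)"
proof -
  define key where "key k = (card {x. snd (run k) x = \<infinity>}, fst (run k))" for k
  have neq: "key j \<noteq> key k" if "j < k" "k < n" for j k
  proof
    assume "key j = key k"
    then have "snd (run j) = snd (run k)"
      using invariant_run[of j] invariant_run[of k] run_mono[of j k] \<open>j < k\<close>
      by (intro invariant_unique[of "fst (run j)"]) (auto simp: key_def)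
    \<comment> \<open>The strict increase in step \<open>j\<close> is never undone, so the iterate
      cannot return to its old value at \<open>k\<close>.\<close>
    moreover have "snd (run j) < snd (run (Suc j))"
      using active that by (intro step_less[OF invariant_run run_step]) simp
    moreover have "snd (run (Suc j)) \<le> snd (run k)"
      using that by (intro run_mono) simp
    ultimately show False
      by simp
  qed
  then have "inj_on key {..<n}"
    by (auto intro!: linorder_inj_onI')
  moreover have "key ` {..<n} \<subseteq> {..<CARD('x)} \<times> strategies E"
    using invariant_run invariant_card_top[OF invariant_run active]
    by (auto simp: key_def invariant_def)
  ultimately have "card {..<n} \<le> card ({..<CARD('x)} \<times> strategies E)"
    by (intro card_inj_on_le) (auto simp: finite_strategies)
  then show ?thesis
    by (simp add: card_cartesian_product)
qed

section \<open>Termination and correctness of the loop\<close>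

lemma strategy_improvement_correct:
  "\<exists>\<sigma> n. strategy_improvement sem E P (\<lambda>e\<in>range E. ninf) (\<lambda>_. - \<infinity>) =
      Some (\<sigma>, least_solution sem E, n) \<and> n \<le> CARD('x) * card (strategies E)"
proof -
  let ?b = "\<lambda>(\<sigma>::'e list \<Rightarrow> 'e, \<rho>, n::nat). \<not> solution sem E \<rho>"
  let ?c = "\<lambda>(\<sigma>, \<rho>, n). let \<sigma>' = P \<sigma> \<rho> in
    (\<sigma>', least_solution_above sem (apply_strategy E \<sigma>') \<rho>, Suc n)"
  let ?s = "((\<lambda>e\<in>range E. ninf), (\<lambda>_. - \<infinity>), 0)"
  have iter: "(?c ^^ k) ?s = (fst (run k), snd (run k), k)" for k
    by (induction k) (simp_all add: step_def Let_def split_beta)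
  \<comment> \<open>The index at which \<open>while_option\<close> takes its result by
    definition.\<close>
  define n where "n = (LEAST k. \<not> ?b ((?c ^^ k) ?s))"
  have stop: "\<exists>k. \<not> ?b ((?c ^^ k) ?s)"
  proof (rule ccontr)
    assume "\<not> ?thesis"
    then have "\<not> solution sem E (snd (run k))" for k
      by (simp add: iter)
    \<comment> \<open>An infinite run would have one active iteration more than the bound
      allows.\<close>
    then show False
      using run_bound[of "Suc (CARD('x) * card (strategies E))"] by auto
  qed
  then have sol: "solution sem E (snd (run n))"
    using LeastI_ex[OF stop] unfolding n_def[symmetric] by (simp add: iter)
  have "\<not> solution sem E (snd (run k))" if "k < n" for k
    using not_less_Least[OF that[unfolded n_def]] by (simp add: iter)
  then have "n \<le> CARD('x) * card (strategies E)"
    by (rule run_bound)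
  \<comment> \<open>The invariant keeps every iterate below the least solution; an iterate that is a
    solution is also above it.\<close>
  moreover have "snd (run n) = least_solution sem E"
    using invariant_run[of n] least_solution_wf(2)[OF mono_system_val[OF morcave] sol]
    by (simp add: invariant_def)
  moreover have "strategy_improvement sem E P (\<lambda>e\<in>range E. ninf) (\<lambda>_. - \<infinity>) =
      Some ((?c ^^ n) ?s)"
    unfolding strategy_improvement_def while_option_def n_def using stop by (simp only: if_True)
  ultimately show ?thesis
    by (simp add: iter)
qed

end

theorem theorem1:
  fixes sem :: "('x::finite, 'e) semantics"
    and E :: "('x, 'e) system"
    and ninf :: 'e
    and P :: "('e list \<Rightarrow> 'e) \<Rightarrow> 'x assignment \<Rightarrow> ('e list \<Rightarrow> 'e)"
  assumes ninf: "\<And>\<rho>. sem ninf \<rho> = - \<infinity>"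
    and morcave: "join_morcave sem E"
    and standard: "standard_form ninf E"
    and operator: "improvement_operator sem E P"
  shows "\<exists>\<sigma> n.
    strategy_improvement sem E P (\<lambda>e\<in>range E. ninf) (\<lambda>_. - \<infinity>) = Some (\<sigma>, least_solution sem E, n) \<and>
    n \<le> CARD('x) * card (strategies E)"
  by (rule strategy_iteration.strategy_improvement_correct)
    (unfold_locales; fact assms)

end
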